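(* Let $N$ be a manifold of dimension $n$. Let $f$ be an immersion of $N$ into an open subset $U$ of $\mathbb{R}^m$. Let $F:U\to\mathbb{R}^\ell$ be a mapping, where $\ell\ge2n$. Then there exists a subset $\Sigma$ of $\mathcal{L}(\mathbb{R}^m,\mathbb{R}^\ell)$ with Lebesgue measure zero such that for any $\pi\in\mathcal{L}(\mathbb{R}^m,\mathbb{R}^\ell)-\Sigma$, the mapping $F_\pi\circ f:N\to\mathbb{R}^\ell$ is an immersion.
   Context: Conventions: $\ell,m,n$ are positive integers; all manifolds and mappings are of class $C^\infty$ and all manifolds are without boundary. $\mathcal{L}(\mathbb{R}^m,\mathbb{R}^\ell)$ is the space of all linear mappings $\mathbb{R}^m\to\mathbb{R}^\ell$, identified with $(\mathbb{R}^m)^\ell$ (via matrices), which gives it Lebesgue measure. For $\pi\in\mathcal{L}(\mathbb{R}^m,\mathbb{R}^\ell)$ and $F:U\to\mathbb{R}^\ell$, $F_\pi=F+\pi|_U:U\to\mathbb{R}^\ell$. *)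

theory Defs
  imports "HOL-Analysis.Analysis"
begin

text \<open>
  \<open>S\<close> is meant to be open. Quantifying over all directions \<open>v\<close> makes
  \<open>Ck_on k S g\<close> say that all iterated directional derivatives of order at most \<open>k\<close> exist and are
  continuous, with those of order less than \<open>k\<close> totally differentiable. In finite dimension, to which
  the types are restricted, this is the usual class \<open>C\<^sup>k\<close>.
\<close>

primrec Ck_on ::
  "nat \<Rightarrow> 'a::euclidean_space set \<Rightarrow> ('a \<Rightarrow> 'b::euclidean_space) \<Rightarrow> bool" where
  "Ck_on 0 S g \<longleftrightarrow> continuous_on S g"
| "Ck_on (Suc k) S g \<longleftrightarrow>
     (\<forall>x\<in>S. g differentiable (at x)) \<and>
     (\<forall>v. Ck_on k S (\<lambda>x. frechet_derivative g (at x) v))"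

definition smooth_on :: "'a::euclidean_space set \<Rightarrow> ('a \<Rightarrow> 'b::euclidean_space) \<Rightarrow> bool" where
  "smooth_on S g \<longleftrightarrow> (\<forall>k. Ck_on k S g)"

text \<open>A chart is a pair of its domain and its coordinate map, whose values off the domain are
  irrelevant.\<close>

type_synonym ('p, 'e) chart = "'p set \<times> ('p \<Rightarrow> 'e)"

definition is_chart :: "'p topology \<Rightarrow> ('p, 'e::euclidean_space) chart \<Rightarrow> bool" where
  "is_chart N c \<longleftrightarrow> (case c of (V, \<phi>) \<Rightarrow>
     openin N V \<and> open (\<phi> ` V) \<and>
     homeomorphic_map (subtopology N V) (top_of_set (\<phi> ` V)) \<phi>)"

definition smoothly_compatible ::
  "('p, 'e::euclidean_space) chart \<Rightarrow> ('p, 'e) chart \<Rightarrow> bool" where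
  "smoothly_compatible c d \<longleftrightarrow> (case c of (V, \<phi>) \<Rightarrow> case d of (W, \<psi>) \<Rightarrow>
     smooth_on (\<phi> ` (V \<inter> W)) (\<psi> \<circ> inv_into V \<phi>))"

text \<open>
  The manifold has no boundary, since charts have open image in the model space \<open>'e\<close>, and its
  dimension is \<open>DIM('e)\<close>. Manifolds are Hausdorff and second countable. The atlas \<open>A\<close> need not be
  maximal.
\<close>

definition smooth_manifold ::
  "'p topology \<Rightarrow> ('p, 'e::euclidean_space) chart set \<Rightarrow> bool" where
  "smooth_manifold N A \<longleftrightarrow>
     Hausdorff_space N \<and>
     second_countable N \<and>
     (\<forall>c\<in>A. is_chart N c) \<and>
     topspace N = (\<Union>c\<in>A. fst c) \<and>
     (\<forall>c\<in>A. \<forall>d\<in>A. smoothly_compatible c d)"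

text \<open>
  Maps from the manifold into an open subset \<open>U\<close> of a Euclidean space, which carries the identity
  chart. The coordinate representation in the chart \<open>(V, \<phi>)\<close> is \<open>f \<circ> inv_into V \<phi>\<close> on the open
  set \<open>\<phi> ` V\<close>, and its derivative represents the differential of \<open>f\<close>.
\<close>

definition smooth_map_into ::
  "'p topology \<Rightarrow> ('p, 'e::euclidean_space) chart set \<Rightarrow> 'b::euclidean_space set \<Rightarrow> ('p \<Rightarrow> 'b) \<Rightarrow> bool"
  where
  "smooth_map_into N A U f \<longleftrightarrow>
     f ` topspace N \<subseteq> U \<and> (\<forall>(V, \<phi>)\<in>A. smooth_on (\<phi> ` V) (f \<circ> inv_into V \<phi>))"

definition immersion_into ::
  "'p topology \<Rightarrow> ('p, 'e::euclidean_space) chart set \<Rightarrow> 'b::euclidean_space set \<Rightarrow> ('p \<Rightarrow> 'b) \<Rightarrow> bool"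
  where
  "immersion_into N A U f \<longleftrightarrow>
     smooth_map_into N A U f \<and>
     (\<forall>(V, \<phi>)\<in>A. \<forall>q\<in>V. inj (frechet_derivative (f \<circ> inv_into V \<phi>) (at (\<phi> q))))"

definition linear_perturbation ::
  "('a::real_vector \<Rightarrow> 'b::real_vector) \<Rightarrow> ('a \<Rightarrow> 'b) \<Rightarrow> 'a \<Rightarrow> 'b" where
  "linear_perturbation F \<pi> = (\<lambda>x. F x + \<pi> x)"

end

theory Submission
  imports Defs
begin

text \<open>
  In a chart, write \<open>g\<close> for \<open>f\<close> and \<open>h\<close> for \<open>F \<circ> f\<close>. The perturbation by the matrix \<open>M\<close> fails to be
  an immersion at \<open>x\<close> exactly if some \<open>v \<noteq> 0\<close> satisfies \<open>Dh(x) v + M (Dg(x) v) = 0\<close>. Since \<open>f\<close> is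
  an immersion, \<open>w = Dg(x) v\<close> is nonzero, so for given \<open>x\<close> and \<open>v\<close> these are \<open>\<ell>\<close> independent affine
  conditions on \<open>M\<close>. The point \<open>x\<close> and the direction of \<open>v\<close> vary in \<open>n + (n - 1)\<close> dimensions, hence
  the bad matrices form a set of dimension at most \<open>m\<ell> - \<ell> + 2n - 1 < m\<ell>\<close>, which has measure zero.

  This count becomes a proof without Grassmannians, sphere bundles or Sard's theorem.
  Normalize \<open>v\<close> by \<open>v\<^sub>i = 1\<close> and choose \<open>j\<close> with \<open>w\<^sub>j \<noteq> 0\<close>. The equation then determines column
  \<open>j\<close> of \<open>M\<close> from the other columns, \<open>x\<close> and \<open>v\<close>. Column \<open>j\<close> has \<open>\<ell> \<ge> 2n\<close> entries, so these can
  store \<open>x\<close> and \<open>v\<close> instead: the bad matrices belonging to \<open>i\<close> and \<open>j\<close> are the image of a part of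
  the space of matrices under a differentiable map into that same space, and \<open>v\<^sub>i = 1\<close> confines this
  part to a hyperplane. Differentiable maps between spaces of equal dimension preserve null sets,
  which gives \<open>negligible_noninjective_linear_perturbations\<close>.

  The passage to the manifold uses countably many charts, which suffice by second countability. That
  an injective differential in one chart is injective in any other follows by the chain rule
  (\<open>immersion_injective_change_of_chart\<close>). Besides, the composite maps have to be
  smooth, for which the class \<open>C\<^sup>k\<close> is shown to be closed under composition (\<open>Ck_on_compose\<close>).
\<close>

section \<open>Closure properties of the class \<open>C\<^sup>k\<close>\<close>

lemma linear_componentwise_sum:
  fixes L :: "'a::euclidean_space \<Rightarrow> 'b::real_vector"
  assumes "linear L"
  shows "L y = (\<Sum>b\<in>Basis. (y \<bullet> b) *\<^sub>R L b)"
proof -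
  have "L y = L (\<Sum>b\<in>Basis. (y \<bullet> b) *\<^sub>R b)" by (simp add: euclidean_representation)
  also have "\<dots> = (\<Sum>b\<in>Basis. (y \<bullet> b) *\<^sub>R L b)"
    using assms by (simp add: linear_sum linear_scale)
  finally show ?thesis .
qed

lemma Ck_on_cong:
  assumes "open S" and "Ck_on k S g" and "\<And>x. x \<in> S \<Longrightarrow> g x = h x"
  shows "Ck_on k S h"
  using assms(2,3)
proof (induction k arbitrary: g h)
  case 0
  then show ?case by (simp add: continuous_on_eq)
next
  case (Suc k)
  have diff: "h differentiable (at x)"
    and D: "frechet_derivative g (at x) = frechet_derivative h (at x)" if "x \<in> S" for x
  proof -
    have "g differentiable (at x)" using Suc.prems(1) that by simp
    then show "h differentiable (at x)"
      by (meson Suc.prems(2) \<open>open S\<close> differentiable_def has_derivative_transform_within_open that)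
    show "frechet_derivative g (at x) = frechet_derivative h (at x)"
      by (rule frechet_derivative_transform_within_open[OF \<open>g differentiable (at x)\<close> \<open>open S\<close> that])
        (rule Suc.prems(2))
  qed
  have "Ck_on k S (\<lambda>x. frechet_derivative h (at x) v)" for v
    by (rule Suc.IH[of "\<lambda>x. frechet_derivative g (at x) v"]) (use Suc.prems(1) D in simp_all)
  with diff show ?case by simp
qed

text \<open>
  Any pointwise formula \<open>D\<close> for the derivative may replace the choice made by
  \<open>frechet_derivative\<close>, whose values outside \<open>S\<close> are uncontrolled. Each closure property below is an
  induction in which this rule exposes a derivative formula of the same shape.
\<close>

lemma Ck_on_SucI:
  assumes "open S" and D: "\<And>x. x \<in> S \<Longrightarrow> (g has_derivative D x) (at x)"
    and "\<And>v. Ck_on k S (\<lambda>x. D x v)"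
  shows "Ck_on (Suc k) S g"
proof -
  have "Ck_on k S (\<lambda>x. frechet_derivative g (at x) v)" for v
    by (rule Ck_on_cong[OF \<open>open S\<close> assms(3)]) (simp add: frechet_derivative_at[OF D, symmetric])
  then show ?thesis using D by (auto simp: differentiable_def)
qed

lemma Ck_on_has_derivative:
  assumes "Ck_on (Suc k) S g" and "x \<in> S"
  shows "(g has_derivative frechet_derivative g (at x)) (at x)"
  using assms by (simp add: frechet_derivative_works)

lemma Ck_on_Suc_imp_Ck_on: "Ck_on (Suc k) S g \<Longrightarrow> Ck_on k S g"
proof (induction k arbitrary: g)
  case 0
  then show ?case
    by (auto intro!: continuous_at_imp_continuous_on differentiable_imp_continuous_within)
next
  case (Suc k)
  have "Ck_on k S (\<lambda>x. frechet_derivative g (at x) v)" for v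
    using Suc.prems unfolding Ck_on.simps(2)[of "Suc k"] by (blast intro: Suc.IH)
  then show ?case using Suc.prems by simp
qed

lemma Ck_on_linear_comp:
  fixes L :: "'b::euclidean_space \<Rightarrow> 'c::euclidean_space"
  assumes "open S" and L: "linear L" and "Ck_on k S g"
  shows "Ck_on k S (\<lambda>x. L (g x))"
  using assms(3)
proof (induction k arbitrary: g)
  case 0
  then show ?case using linear_continuous_on_compose[OF _ L] by simp
next
  case (Suc k)
  show ?case
  proof (rule Ck_on_SucI[OF \<open>open S\<close>])
    show "((\<lambda>x. L (g x)) has_derivative (\<lambda>v. L (frechet_derivative g (at x) v))) (at x)"
      if "x \<in> S" for x
      using L Ck_on_has_derivative[OF Suc.prems that]
      by (simp add: bounded_linear.has_derivative linear_conv_bounded_linear)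
    show "Ck_on k S (\<lambda>x. L (frechet_derivative g (at x) v))" for v
      using Suc by simp
  qed
qed

lemma Ck_on_add:
  assumes "open S" and "Ck_on k S g" and "Ck_on k S h"
  shows "Ck_on k S (\<lambda>x. g x + h x)"
  using assms(2,3)
proof (induction k arbitrary: g h)
  case 0
  then show ?case by (simp add: continuous_on_add)
next
  case (Suc k)
  show ?case
  proof (rule Ck_on_SucI[OF \<open>open S\<close>])
    show "((\<lambda>x. g x + h x) has_derivative
        (\<lambda>v. frechet_derivative g (at x) v + frechet_derivative h (at x) v)) (at x)"
      if "x \<in> S" for x
      using Suc.prems that by (intro has_derivative_add Ck_on_has_derivative)
    show "Ck_on k S (\<lambda>x. frechet_derivative g (at x) v + frechet_derivative h (at x) v)" for v
      using Suc by simp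
  qed
qed

lemma Ck_on_const: "Ck_on k S (\<lambda>x. c)"
  by (induction k arbitrary: c) (simp_all add: frechet_derivative_const)

lemma Ck_on_ident: "open S \<Longrightarrow> Ck_on k S (\<lambda>x. x)"
  by (cases k) (auto intro: Ck_on_SucI has_derivative_ident Ck_on_const simp del: Ck_on.simps(2))

lemma Ck_on_sum:
  assumes "open S" and "finite I" and "\<And>i. i \<in> I \<Longrightarrow> Ck_on k S (g i)"
  shows "Ck_on k S (\<lambda>x. \<Sum>i\<in>I. g i x)"
  using assms(2,3) by (induction I) (auto intro!: Ck_on_add Ck_on_const \<open>open S\<close>)

lemma Ck_on_scaleR:
  assumes "open S" and "Ck_on k S c" and "Ck_on k S g"
  shows "Ck_on k S (\<lambda>x. c x *\<^sub>R g x)"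
  using assms(2,3)
proof (induction k arbitrary: c g)
  case 0
  then show ?case by (simp add: continuous_on_scaleR)
next
  case (Suc k)
  show ?case
  proof (rule Ck_on_SucI[OF \<open>open S\<close>])
    show "((\<lambda>x. c x *\<^sub>R g x) has_derivative
        (\<lambda>v. c x *\<^sub>R frechet_derivative g (at x) v + frechet_derivative c (at x) v *\<^sub>R g x)) (at x)"
      if "x \<in> S" for x
      using Suc.prems that by (intro has_derivative_scaleR Ck_on_has_derivative)
    show "Ck_on k S (\<lambda>x. c x *\<^sub>R frechet_derivative g (at x) v + frechet_derivative c (at x) v *\<^sub>R g x)"
      for v
      using Suc.IH Suc.prems Suc.prems[THEN Ck_on_Suc_imp_Ck_on]
      by (intro Ck_on_add \<open>open S\<close>) auto
  qed
qed

text \<open>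
  The chain rule gives the derivative \<open>DF(g x) (Dg(x) v)\<close>, whose inner argument depends on \<open>x\<close> as
  well. Expanding it in the standard basis separates the two dependences: the result is a sum of
  products of the functions \<open>Dg(x) v \<bullet> b\<close> with the functions \<open>DF(g x) b\<close>, and the latter are
  compositions of \<open>g\<close> with directional derivatives of \<open>F\<close>, to which the induction hypothesis applies.
\<close>

lemma Ck_on_compose:
  assumes "open S" and "open T"
    and "Ck_on k T F" and "Ck_on k S g" and "g ` S \<subseteq> T"
  shows "Ck_on k S (\<lambda>x. F (g x))"
  using assms(3-5)
proof (induction k arbitrary: F)
  case 0
  then show ?case using continuous_on_compose2[of T F S g] by simp
next
  case (Suc k)
  show ?case
  proof (rule Ck_on_SucI[OF \<open>open S\<close>])
    fix x assume "x \<in> S"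
    then have "g x \<in> T" using Suc.prems(3) by auto
    note Dg = Ck_on_has_derivative[OF Suc.prems(2) \<open>x \<in> S\<close>]
      and DF = Ck_on_has_derivative[OF Suc.prems(1) \<open>g x \<in> T\<close>]
    have "(\<lambda>v. frechet_derivative F (at (g x)) (frechet_derivative g (at x) v)) =
        (\<lambda>v. \<Sum>b\<in>Basis. (frechet_derivative g (at x) v \<bullet> b) *\<^sub>R frechet_derivative F (at (g x)) b)"
      using linear_componentwise_sum[OF has_derivative_linear[OF DF]] by blast
    then show "((\<lambda>x. F (g x)) has_derivative
        (\<lambda>v. \<Sum>b\<in>Basis. (frechet_derivative g (at x) v \<bullet> b) *\<^sub>R frechet_derivative F (at (g x)) b))
        (at x)"
      using diff_chain_at[OF Dg DF] by (simp add: comp_def)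
  next
    fix v
    show "Ck_on k S (\<lambda>x. \<Sum>b\<in>Basis.
        (frechet_derivative g (at x) v \<bullet> b) *\<^sub>R frechet_derivative F (at (g x)) b)"
    proof (intro Ck_on_sum Ck_on_scaleR \<open>open S\<close> finite_Basis)
      show "Ck_on k S (\<lambda>x. frechet_derivative g (at x) v \<bullet> b)" for b
        using Suc.prems(2)
        by (intro Ck_on_linear_comp[where L = "\<lambda>y. y \<bullet> b"] \<open>open S\<close>)
          (auto simp: linear_iff inner_add_left)
      show "Ck_on k S (\<lambda>x. frechet_derivative F (at (g x)) b)" for b
        using Suc.prems Ck_on_Suc_imp_Ck_on[OF Suc.prems(2)]
        by (intro Suc.IH[where F = "\<lambda>y. frechet_derivative F (at y) b"]) auto
    qed
  qed
qed


section \<open>The bad matrices of an immersed open set\<close>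

text \<open>
  Differentiability relative to \<open>D\<close> is what makes this usable when \<open>X\<close> maps only \<open>D\<close> into \<open>W\<close>: at
  the values of \<open>X\<close> nearby, the Frechet derivative of \<open>g\<close> need not exist.
\<close>

lemma differentiable_on_frechet_derivative_apply:
  fixes g :: "'a::euclidean_space \<Rightarrow> 'b::euclidean_space"
  assumes "Ck_on 2 W g" and "X ` D \<subseteq> W"
    and "X differentiable_on D" and "Y differentiable_on D"
  shows "(\<lambda>p. frechet_derivative g (at (X p)) (Y p)) differentiable_on D"
  unfolding differentiable_on_def
proof
  fix p assume "p \<in> D"
  have g: "g differentiable (at x)" "(\<lambda>x. frechet_derivative g (at x) b) differentiable (at x)"
    if "x \<in> W" for x b
    using assms(1) that by (simp_all add: numeral_2_eq_2)
  have XY: "X differentiable (at p within D)" "Y differentiable (at p within D)" "X p \<in> W"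
    using assms(2-4) \<open>p \<in> D\<close> by (auto simp: differentiable_on_def)
  have "(\<lambda>p. frechet_derivative g (at (X p)) b) differentiable (at p within D)" for b
    using differentiable_compose[OF g(2)[OF XY(3)] XY(1)] .
  then have "(\<lambda>p. \<Sum>b\<in>Basis. (Y p \<bullet> b) *\<^sub>R frechet_derivative g (at (X p)) b)
      differentiable (at p within D)"
    using XY(2) by (intro differentiable_sum) auto
  moreover have "(\<Sum>b\<in>Basis. (Y p \<bullet> b) *\<^sub>R frechet_derivative g (at (X p)) b)
      = frechet_derivative g (at (X p)) (Y p)" if "p \<in> D" for p
    using linear_componentwise_sum[OF linear_frechet_derivative[OF g(1)]] assms(2) that
    by (metis image_subset_iff)
  ultimately show "(\<lambda>p. frechet_derivative g (at (X p)) (Y p)) differentiable (at p within D)"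
    using \<open>p \<in> D\<close> by (auto intro: differentiable_transform_within[OF _ zero_less_one])
qed

lemma differentiable_on_linear_comp:
  fixes L :: "'b::euclidean_space \<Rightarrow> 'c::real_normed_vector"
  assumes "linear L" and "g differentiable_on D"
  shows "(\<lambda>x. L (g x)) differentiable_on D"
  using assms unfolding differentiable_on_def
  by (blast intro: differentiable_compose linear_imp_differentiable)

lemma differentiable_on_matrix_vector_mult:
  fixes P :: "'a::euclidean_space \<Rightarrow> real ^ 'm ^ 'l" and w :: "'a \<Rightarrow> real ^ 'm"
  assumes "P differentiable_on D" and "w differentiable_on D"
  shows "(\<lambda>p. P p *v w p) differentiable_on D"
proof -
  have "bilinear ((*v) :: real ^ 'm ^ 'l \<Rightarrow> real ^ 'm \<Rightarrow> real ^ 'l)"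
    by (auto simp: bilinear_def linear_iff matrix_vector_mult_add_rdistrib
        matrix_vector_right_distrib scaleR_matrix_vector_assoc matrix_vector_mult_scaleR)
  then have "bounded_bilinear ((*v) :: real ^ 'm ^ 'l \<Rightarrow> real ^ 'm \<Rightarrow> real ^ 'l)"
    by (simp add: bilinear_conv_bounded_bilinear)
  from bounded_bilinear.FDERIV[OF this] assms show ?thesis
    unfolding differentiable_on_def differentiable_def by blast
qed

definition matrix_with_column :: "'m \<Rightarrow> real ^ 'l \<Rightarrow> real ^ 'm ^ 'l" where
  "matrix_with_column j r = (\<chi> a b. if b = j then r $ a else 0)"

lemma linear_matrix_with_column: "linear (matrix_with_column j)"
  by (auto simp: linear_iff matrix_with_column_def vec_eq_iff)

lemma matrix_with_column_mult: "matrix_with_column j r *v w = (w $ j) *\<^sub>R r"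
  by (simp add: vec_eq_iff matrix_with_column_def matrix_vector_mult_def if_distribR
      mult.commute[of "r $ _"] if_distrib[of "\<lambda>x. x * _"] cong: if_cong)

text \<open>
  If \<open>w $ j \<noteq> 0\<close>, the matrix that agrees with \<open>P\<close> off column \<open>j\<close> and solves the equation
  \<open>y + M *v w = 0\<close> for \<open>M\<close>: the residual \<open>y + P *v w\<close>, scaled by \<open>1 / w $ j\<close>, is subtracted from
  column \<open>j\<close>. In this form the dependence on \<open>w\<close>, \<open>y\<close> and \<open>P\<close> is visibly differentiable, and column
  \<open>j\<close> of \<open>P\<close> cancels out.
\<close>

definition correct_column ::
  "'m \<Rightarrow> real ^ 'm \<Rightarrow> real ^ 'l \<Rightarrow> real ^ 'm ^ 'l \<Rightarrow> real ^ 'm ^ 'l" where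
  "correct_column j w y P = P - inverse (w $ j) *\<^sub>R matrix_with_column j (y + P *v w)"

lemma correct_column_eq:
  assumes "w $ j \<noteq> 0" and "y + M *v w = 0" and P: "\<And>a b. b \<noteq> j \<Longrightarrow> P $ a $ b = M $ a $ b"
  shows "correct_column j w y P = M"
proof -
  let ?r = "\<chi> a. P $ a $ j - M $ a $ j"
  have diff: "P = M + matrix_with_column j ?r"
    using P by (simp add: vec_eq_iff matrix_with_column_def)
  have "y + P *v w = (w $ j) *\<^sub>R ?r"
    using assms(2) by (subst diff)
      (simp add: matrix_vector_mult_add_rdistrib matrix_with_column_mult add.assoc[symmetric])
  then have "inverse (w $ j) *\<^sub>R matrix_with_column j (y + P *v w) = matrix_with_column j ?r"
    using assms(1) by (simp add: linear_scale[OF linear_matrix_with_column])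
  then show ?thesis using diff unfolding correct_column_def by (metis add_diff_cancel_right')
qed

text \<open>
  The image of a part of a hyperplane of matrices under a differentiable map contains all bad matrices with
  given \<open>i\<close> and \<open>j\<close>. For a bad matrix \<open>M\<close>, the preimage \<open>P\<close> is \<open>M\<close> with the coordinates of \<open>x\<close> and
  \<open>v\<close> written over column \<open>j\<close>, at the positions given by an injection of two copies of \<open>'n\<close> into
  \<open>'l\<close>. Two derivatives are needed because \<open>Dg(x) v\<close> and \<open>Dh(x) v\<close> have to be differentiable in
  \<open>x\<close>.
\<close>

lemma negligible_noninjective_linear_perturbations:
  fixes g :: "real ^ 'n \<Rightarrow> real ^ 'm" and h :: "real ^ 'n \<Rightarrow> real ^ 'l"
  assumes g: "Ck_on 2 W g" and h: "Ck_on 2 W h"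
    and inj: "\<And>x. x \<in> W \<Longrightarrow> inj (frechet_derivative g (at x))"
    and dim: "2 * CARD('n) \<le> CARD('l)"
  shows "negligible {M :: real ^ 'm ^ 'l. \<exists>x\<in>W. \<exists>v. v \<noteq> 0 \<and>
      frechet_derivative h (at x) v + M *v frechet_derivative g (at x) v = 0}"
    (is "negligible ?Bad")
proof -
  have "card (UNIV :: ('n + 'n) set) \<le> card (UNIV :: 'l set)"
    using dim by (simp add: card_UNIV_sum)
  then obtain e :: "'n + 'n \<Rightarrow> 'l" where e: "inj e"
    using card_le_inj[of "UNIV :: ('n + 'n) set" "UNIV :: 'l set"] by auto
  \<comment> \<open>Column \<open>j\<close> of \<open>P\<close> encodes a point \<open>X j P\<close> and a tangent vector \<open>Y j P\<close>; \<open>\<Phi> j\<close> decodes them and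
    then solves for the true column.\<close>
  define X :: "'m \<Rightarrow> real ^ 'm ^ 'l \<Rightarrow> real ^ 'n" where "X j P = (\<chi> c. P $ e (Inl c) $ j)" for j P
  define Y :: "'m \<Rightarrow> real ^ 'm ^ 'l \<Rightarrow> real ^ 'n" where "Y j P = (\<chi> c. P $ e (Inr c) $ j)" for j P
  define w where "w j P = frechet_derivative g (at (X j P)) (Y j P)" for j P
  define y where "y j P = frechet_derivative h (at (X j P)) (Y j P)" for j P
  define D where "D i j = {P. X j P \<in> W \<and> Y j P $ i = 1 \<and> w j P $ j \<noteq> 0}" for i j
  define \<Phi> where "\<Phi> j P = correct_column j (w j P) (y j P) P" for j P
  have neg: "negligible (\<Phi> j ` D i j)" for i j
  proof (rule negligible_differentiable_image_negligible[OF order_refl])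
    have "negligible {P :: real ^ 'm ^ 'l. axis (e (Inr i)) (axis j 1) \<bullet> P = 1}"
      by (rule negligible_hyperplane) simp
    then show "negligible (D i j)"
      by (rule negligible_subset) (auto simp: D_def Y_def inner_axis')
    have "linear (X j)" "linear (Y j)"
      by (auto simp: linear_iff X_def Y_def vec_eq_iff)
    then have XY: "X j differentiable_on D i j" "Y j differentiable_on D i j"
      by (auto intro: linear_imp_differentiable_on)
    have "X j ` D i j \<subseteq> W" by (auto simp: D_def)
    then have w: "w j differentiable_on D i j" and y: "y j differentiable_on D i j"
      using XY g h unfolding w_def y_def
      by (auto intro!: differentiable_on_frechet_derivative_apply)
    have "(\<lambda>P. inverse (w j P $ j)) differentiable_on D i j"
      using differentiable_on_linear_comp[OF _ w, of "\<lambda>v. v $ j"]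
      by (intro differentiable_on_inverse) (auto simp: D_def linear_iff)
    moreover have "(\<lambda>P. matrix_with_column j (y j P + P *v w j P)) differentiable_on D i j"
      by (intro differentiable_on_linear_comp[OF linear_matrix_with_column] differentiable_on_add y
          differentiable_on_matrix_vector_mult differentiable_on_ident w)
    ultimately show "\<Phi> j differentiable_on D i j"
      unfolding \<Phi>_def correct_column_def
      by (intro differentiable_on_diff differentiable_on_scaleR differentiable_on_ident)
  qed
  have "?Bad \<subseteq> (\<Union>i. \<Union>j. \<Phi> j ` D i j)"
  proof clarify
    fix M :: "real ^ 'm ^ 'l" and x :: "real ^ 'n" and v :: "real ^ 'n"
    assume "x \<in> W" and "v \<noteq> 0"
      and eq: "frechet_derivative h (at x) v + M *v frechet_derivative g (at x) v = 0"
    have lin: "linear (frechet_derivative g (at x))" "linear (frechet_derivative h (at x))"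
      using g h \<open>x \<in> W\<close> by (auto intro!: linear_frechet_derivative simp: numeral_2_eq_2)
    obtain i where "v $ i \<noteq> 0" using \<open>v \<noteq> 0\<close> by (auto simp: vec_eq_iff)
    define u where "u = inverse (v $ i) *\<^sub>R v"
    have "u $ i = 1" using \<open>v $ i \<noteq> 0\<close> by (simp add: u_def)
    have equ: "frechet_derivative h (at x) u + M *v frechet_derivative g (at x) u = 0"
      using eq by (simp add: u_def linear_scale[OF lin(1)] linear_scale[OF lin(2)]
          matrix_vector_mult_scaleR scaleR_add_right[symmetric])
    have "frechet_derivative g (at x) u \<noteq> 0"
      using linear_injective_0[OF lin(1)] inj[OF \<open>x \<in> W\<close>] \<open>u $ i = 1\<close> by force
    then obtain j where j: "frechet_derivative g (at x) u $ j \<noteq> 0" by (auto simp: vec_eq_iff)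
    \<comment> \<open>Entries of column \<open>j\<close> outside the range of \<open>e\<close> are arbitrary, since \<open>\<Phi> j\<close> ignores them.\<close>
    define P :: "real ^ 'm ^ 'l" where
      "P = (\<chi> a b. if b = j then (case inv e a of Inl c \<Rightarrow> x $ c | Inr c \<Rightarrow> u $ c) else M $ a $ b)"
    have "X j P = x" "Y j P = u" by (simp_all add: X_def Y_def P_def vec_eq_iff e)
    then have "P \<in> D i j" and "w j P = frechet_derivative g (at x) u"
      and "y j P = frechet_derivative h (at x) u"
      using \<open>x \<in> W\<close> \<open>u $ i = 1\<close> j by (simp_all add: D_def w_def y_def)
    moreover have "correct_column j (frechet_derivative g (at x) u)
        (frechet_derivative h (at x) u) P = M"
      by (rule correct_column_eq[OF j equ]) (simp add: P_def)
    ultimately show "M \<in> (\<Union>i. \<Union>j. \<Phi> j ` D i j)" by (force simp: \<Phi>_def)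
  qed
  moreover have "negligible (\<Union>i. \<Union>j. \<Phi> j ` D i j)"
    by (intro negligible_Union) (auto intro!: negligible_Union neg)
  ultimately show ?thesis by (rule negligible_subset[rotated])
qed

section \<open>Differentials in different charts\<close>

lemma smooth_on_imp_differentiable: "smooth_on S g \<Longrightarrow> x \<in> S \<Longrightarrow> g differentiable (at x)"
  unfolding smooth_on_def by (metis Ck_on.simps(2))

lemma smooth_manifold_chart:
  assumes "smooth_manifold N A" and "(V, \<phi>) \<in> A"
  shows "openin N V" and "inj_on \<phi> V"
    and "\<And>O'. openin N O' \<Longrightarrow> O' \<subseteq> V \<Longrightarrow> open (\<phi> ` O')"
proof -
  have "is_chart N (V, \<phi>)" using assms by (auto simp: smooth_manifold_def)
  then have V: "openin N V" "open (\<phi> ` V)"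
    and hom: "homeomorphic_map (subtopology N V) (top_of_set (\<phi> ` V)) \<phi>"
    by (auto simp: is_chart_def)
  show "openin N V" by fact
  have top: "topspace (subtopology N V) = V"
    using V(1) openin_subset by fastforce
  show "inj_on \<phi> V" using homeomorphic_imp_injective_map[OF hom] top by simp
  show "open (\<phi> ` O')" if "openin N O'" "O' \<subseteq> V" for O'
  proof -
    have "openin (subtopology N V) O'"
      using that by (simp add: openin_subset_topspace_eq subset_openin_subtopology)
    then have "openin (top_of_set (\<phi> ` V)) (\<phi> ` O')"
      using homeomorphic_imp_open_map[OF hom] by (simp add: open_map_def)
    then show ?thesis using V(2) by (rule openin_open_trans)
  qed
qed

lemma smooth_manifold_countable_subatlas:
  assumes "smooth_manifold N A"
  obtains B where "countable B" and "B \<subseteq> A" and "topspace N = (\<Union>c\<in>B. fst c)"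
proof -
  have "Lindelof_space N"
    using assms by (simp add: smooth_manifold_def second_countable_imp_Lindelof_space)
  moreover have "openin N V" if "V \<in> fst ` A" for V
    using that smooth_manifold_chart(1)[OF assms] by auto
  moreover have "\<Union>(fst ` A) = topspace N"
    using assms by (simp add: smooth_manifold_def)
  ultimately obtain \<V> where "countable \<V>" "\<V> \<subseteq> fst ` A" "\<Union>\<V> = topspace N"
    using Lindelof_spaceD[of N "fst ` A"] by metis
  then obtain B where "countable B" "B \<subseteq> A" "\<V> = fst ` B"
    by (metis countable_subset_image)
  then show thesis using that \<open>\<Union>\<V> = topspace N\<close> by blast
qed

lemma smooth_manifold_change_of_chart:
  fixes g :: "'p \<Rightarrow> 'b::euclidean_space"
  assumes M: "smooth_manifold N A" and c: "(V, \<phi>) \<in> A" and d: "(W, \<psi>) \<in> A"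
    and q: "q \<in> V" "q \<in> W" and g: "(g \<circ> inv_into W \<psi>) differentiable (at (\<psi> q))"
  shows "frechet_derivative (g \<circ> inv_into V \<phi>) (at (\<phi> q)) =
    frechet_derivative (g \<circ> inv_into W \<psi>) (at (\<psi> q)) \<circ>
    frechet_derivative (\<psi> \<circ> inv_into V \<phi>) (at (\<phi> q))"
proof -
  let ?\<tau> = "\<psi> \<circ> inv_into V \<phi>"
  note chart = smooth_manifold_chart[OF M c] smooth_manifold_chart[OF M d]
  have "smoothly_compatible (V, \<phi>) (W, \<psi>)" using M c d by (auto simp: smooth_manifold_def)
  then have \<tau>: "?\<tau> differentiable (at (\<phi> q))"
    using q by (auto simp: smoothly_compatible_def intro: smooth_on_imp_differentiable)
  have \<tau>q: "?\<tau> (\<phi> q) = \<psi> q" using chart(2) q by simp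
  have op: "open (\<phi> ` (V \<inter> W))" using chart by (intro chart(3)) auto
  have "frechet_derivative ((g \<circ> inv_into W \<psi>) \<circ> ?\<tau>) (at (\<phi> q)) =
      frechet_derivative (g \<circ> inv_into V \<phi>) (at (\<phi> q))"
  proof (rule frechet_derivative_transform_within_open[OF _ op])
    show "((g \<circ> inv_into W \<psi>) \<circ> ?\<tau>) differentiable (at (\<phi> q))"
      using g by (intro differentiable_chain_at \<tau>) (simp add: \<tau>q[unfolded comp_def])
    show "\<phi> q \<in> \<phi> ` (V \<inter> W)" using q by blast
    show "((g \<circ> inv_into W \<psi>) \<circ> ?\<tau>) x = (g \<circ> inv_into V \<phi>) x" if "x \<in> \<phi> ` (V \<inter> W)" for x
      using that chart(2,5) by auto
  qed
  moreover have "frechet_derivative ((g \<circ> inv_into W \<psi>) \<circ> ?\<tau>) (at (\<phi> q)) =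
      frechet_derivative (g \<circ> inv_into W \<psi>) (at (?\<tau> (\<phi> q))) \<circ> frechet_derivative ?\<tau> (at (\<phi> q))"
    using g \<tau> \<tau>q by (intro frechet_derivative_compose) simp_all
  ultimately show ?thesis using \<tau>q by simp
qed

text \<open>
  Both \<open>f\<close> and \<open>g\<close> change their differential by the differential \<open>T\<close> of the same transition map.
  The immersion \<open>f\<close> shows that \<open>T\<close> is injective, as a right factor of an injective map; this spares
  an argument with the inverse transition map.
\<close>

lemma immersion_injective_change_of_chart:
  fixes f :: "'p \<Rightarrow> 'b::euclidean_space" and g :: "'p \<Rightarrow> 'c::euclidean_space"
  assumes M: "smooth_manifold N A" and c: "(V, \<phi>) \<in> A" and d: "(W, \<psi>) \<in> A"
    and q: "q \<in> V" "q \<in> W" and f: "immersion_into N A U f" and g: "smooth_map_into N A U' g"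
    and inj: "inj (frechet_derivative (g \<circ> inv_into W \<psi>) (at (\<psi> q)))"
  shows "inj (frechet_derivative (g \<circ> inv_into V \<phi>) (at (\<phi> q)))"
proof -
  let ?T = "frechet_derivative (\<psi> \<circ> inv_into V \<phi>) (at (\<phi> q))"
  have "(f \<circ> inv_into W \<psi>) differentiable (at (\<psi> q))" "(g \<circ> inv_into W \<psi>) differentiable (at (\<psi> q))"
    using f g d q(2)
    by (auto simp: immersion_into_def smooth_map_into_def intro!: smooth_on_imp_differentiable)
  note eqs = this[THEN smooth_manifold_change_of_chart[OF M c d q]]
  have "inj (frechet_derivative (f \<circ> inv_into V \<phi>) (at (\<phi> q)))"
    using f c q(1) by (auto simp: immersion_into_def)
  then have "inj ?T" unfolding eqs(1) by (rule inj_on_imageI2)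
  then show ?thesis unfolding eqs(2) using inj by (rule inj_compose[rotated])
qed

lemma smooth_map_into_in_chart:
  assumes M: "smooth_manifold N A" and f: "smooth_map_into N A U f" and c: "(V, \<phi>) \<in> A"
  shows "open (\<phi> ` V)" and "smooth_on (\<phi> ` V) (f \<circ> inv_into V \<phi>)"
    and "(f \<circ> inv_into V \<phi>) ` (\<phi> ` V) \<subseteq> U"
proof -
  show "open (\<phi> ` V)" using smooth_manifold_chart[OF M c] by blast
  show "smooth_on (\<phi> ` V) (f \<circ> inv_into V \<phi>)" using f c by (auto simp: smooth_map_into_def)
  have "V \<subseteq> topspace N" using smooth_manifold_chart(1)[OF M c] by (rule openin_subset)
  then show "(f \<circ> inv_into V \<phi>) ` (\<phi> ` V) \<subseteq> U"
    using f smooth_manifold_chart(2)[OF M c] unfolding smooth_map_into_def by (auto simp: image_subset_iff)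
qed

lemma smooth_on_compose:
  assumes "open S" and "open T" and "smooth_on T F" and "smooth_on S g" and "g ` S \<subseteq> T"
  shows "smooth_on S (F \<circ> g)"
  using assms Ck_on_compose[of S T _ F g] by (simp add: smooth_on_def comp_def)

lemma smooth_on_linear_perturbation:
  fixes F :: "'a::euclidean_space \<Rightarrow> 'b::euclidean_space"
  assumes "open U" and "smooth_on U F" and "linear \<pi>"
  shows "smooth_on U (linear_perturbation F \<pi>)"
  using assms Ck_on_linear_comp[OF assms(1,3) Ck_on_ident[OF assms(1)]]
  by (simp add: smooth_on_def linear_perturbation_def Ck_on_add)

lemma smooth_map_into_compose:
  assumes "smooth_manifold N A" and "open U" and "smooth_map_into N A U f" and "smooth_on U G"
  shows "smooth_map_into N A UNIV (G \<circ> f)"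
proof -
  have "smooth_on (\<phi> ` V) (G \<circ> f \<circ> inv_into V \<phi>)" if "(V, \<phi>) \<in> A" for V \<phi>
    unfolding comp_assoc
    by (rule smooth_on_compose[OF smooth_map_into_in_chart(1)[OF assms(1,3) that] assms(2,4)
          smooth_map_into_in_chart(2,3)[OF assms(1,3) that]])
  then show ?thesis by (auto simp: smooth_map_into_def)
qed

lemma frechet_derivative_linear_perturbation_comp:
  fixes F :: "'b::euclidean_space \<Rightarrow> 'c::euclidean_space"
  assumes g: "g differentiable (at x)" and F: "(F \<circ> g) differentiable (at x)" and "linear \<pi>"
  shows "frechet_derivative (linear_perturbation F \<pi> \<circ> g) (at x) v =
    frechet_derivative (F \<circ> g) (at x) v + \<pi> (frechet_derivative g (at x) v)"
proof -
  have "((\<lambda>x. (F \<circ> g) x + \<pi> (g x)) has_derivative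
      (\<lambda>v. frechet_derivative (F \<circ> g) (at x) v + \<pi> (frechet_derivative g (at x) v))) (at x)"
    using assms bounded_linear.has_derivative[of \<pi> g "frechet_derivative g (at x)"]
    unfolding frechet_derivative_works linear_conv_bounded_linear by (intro has_derivative_add)
  then have "(linear_perturbation F \<pi> \<circ> g has_derivative
      (\<lambda>v. frechet_derivative (F \<circ> g) (at x) v + \<pi> (frechet_derivative g (at x) v))) (at x)"
    by (simp add: linear_perturbation_def comp_def)
  from frechet_derivative_at[OF this] show ?thesis by metis
qed

section \<open>Immersions after generic linear perturbation\<close>

theorem corollary3:
  fixes N :: "'p topology"
    and A :: "('p, real ^ 'n) chart set"
    and U :: "(real ^ 'm) set"
    and f :: "'p \<Rightarrow> real ^ 'm"
    and F :: "real ^ 'm \<Rightarrow> real ^ 'l"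
  assumes "smooth_manifold N A"
    and "open U"
    and "immersion_into N A U f"
    and "smooth_on U F"
    and "CARD('l) \<ge> 2 * CARD('n)"
  shows "\<exists>\<Sigma> \<subseteq> {\<pi> :: real ^ 'm \<Rightarrow> real ^ 'l. linear \<pi>}.
           matrix ` \<Sigma> \<in> null_sets lebesgue \<and>
           (\<forall>\<pi> \<in> {\<pi>. linear \<pi>} - \<Sigma>. immersion_into N A UNIV (linear_perturbation F \<pi> \<circ> f))"
proof -
  note M = assms(1) and U = assms(2) and f = assms(3) and F = assms(4)
  have fs: "smooth_map_into N A U f" using f by (simp add: immersion_into_def)
  note in_chart = smooth_map_into_in_chart[OF M fs]
  obtain B where B: "countable B" "B \<subseteq> A" "topspace N = (\<Union>c\<in>B. fst c)"
    using smooth_manifold_countable_subatlas[OF M] .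
  \<comment> \<open>Only the charts in \<open>B\<close> contribute, so that the union of the sets \<open>Bad c\<close> stays null; failures
    seen in other charts are transported to \<open>B\<close> below.\<close>
  define Bad :: "('p, real ^ 'n) chart \<Rightarrow> (real ^ 'm ^ 'l) set" where
    "Bad = (\<lambda>(V, \<phi>). {M. \<exists>x \<in> \<phi> ` V. \<exists>v. v \<noteq> 0 \<and>
      frechet_derivative (F \<circ> (f \<circ> inv_into V \<phi>)) (at x) v +
      M *v frechet_derivative (f \<circ> inv_into V \<phi>) (at x) v = 0})"
  have Ff: "smooth_on (\<phi> ` V) (F \<circ> (f \<circ> inv_into V \<phi>))" if "(V, \<phi>) \<in> A" for V \<phi>
    by (rule smooth_on_compose[OF in_chart(1)[OF that] U F in_chart(2,3)[OF that]])
  have neg: "negligible (Bad c)" if cA: "c \<in> A" for c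
  proof -
    obtain V \<phi> where c: "c = (V, \<phi>)" "(V, \<phi>) \<in> A" using cA by (cases c) auto
    show ?thesis unfolding c(1) Bad_def prod.case
    proof (rule negligible_noninjective_linear_perturbations)
      show "inj (frechet_derivative (f \<circ> inv_into V \<phi>) (at x))" if "x \<in> \<phi> ` V" for x
        using f c(2) that by (auto simp: immersion_into_def)
    qed (use in_chart[OF c(2)] Ff[OF c(2)] assms(5) in \<open>auto simp: smooth_on_def\<close>)
  qed
  define \<Sigma> where
    "\<Sigma> = {\<pi>. linear \<pi> \<and> \<not> immersion_into N A UNIV (linear_perturbation F \<pi> \<circ> f)}"
  have "matrix \<pi> \<in> (\<Union>c\<in>B. Bad c)" if "\<pi> \<in> \<Sigma>" for \<pi>
  proof -
    let ?G = "linear_perturbation F \<pi>"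
    have lin: "linear \<pi>" and no: "\<not> immersion_into N A UNIV (?G \<circ> f)"
      using that by (auto simp: \<Sigma>_def)
    have Gf: "smooth_map_into N A UNIV (?G \<circ> f)"
      using smooth_map_into_compose[OF M U fs smooth_on_linear_perturbation[OF U F lin]] .
    obtain V \<phi> q where c: "(V, \<phi>) \<in> A" "q \<in> V"
      and ninj: "\<not> inj (frechet_derivative (?G \<circ> f \<circ> inv_into V \<phi>) (at (\<phi> q)))"
      using no Gf by (auto simp: immersion_into_def)
    have "q \<in> topspace N" using c openin_subset[OF smooth_manifold_chart(1)[OF M c(1)]] by blast
    then obtain W \<psi> where d: "(W, \<psi>) \<in> B" "q \<in> W" using B(3) by auto
    then have dA: "(W, \<psi>) \<in> A" using B(2) by blast
    have "\<psi> q \<in> \<psi> ` W" using d(2) by blast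
    let ?D = "frechet_derivative (?G \<circ> (f \<circ> inv_into W \<psi>)) (at (\<psi> q))"
    have "\<not> inj ?D"
      using immersion_injective_change_of_chart[OF M c(1) dA c(2) d(2) f Gf] ninj
      by (auto simp: comp_assoc)
    moreover have "linear ?D"
      using smooth_map_into_in_chart(2)[OF M Gf dA] \<open>\<psi> q \<in> \<psi> ` W\<close>
      by (intro linear_frechet_derivative) (auto simp: comp_assoc intro: smooth_on_imp_differentiable)
    ultimately obtain v where v: "v \<noteq> 0" "?D v = 0" by (auto simp: linear_injective_0)
    have "?D v = frechet_derivative (F \<circ> (f \<circ> inv_into W \<psi>)) (at (\<psi> q)) v +
        \<pi> (frechet_derivative (f \<circ> inv_into W \<psi>) (at (\<psi> q)) v)"
      using in_chart(2)[OF dA] Ff[OF dA] \<open>\<psi> q \<in> \<psi> ` W\<close> lin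
      by (intro frechet_derivative_linear_perturbation_comp smooth_on_imp_differentiable)
    with v have "matrix \<pi> \<in> Bad (W, \<psi>)"
      using \<open>\<psi> q \<in> \<psi> ` W\<close> by (simp add: Bad_def lin del: bex_simps image_eqI) metis
    then show ?thesis using d(1) by blast
  qed
  moreover have "negligible (\<Union>c\<in>B. Bad c)"
    using B(1,2) neg by (intro negligible_countable_Union) auto
  ultimately have "matrix ` \<Sigma> \<in> null_sets lebesgue"
    unfolding negligible_iff_null_sets[symmetric] by (meson image_subsetI negligible_subset)
  then show ?thesis by (intro exI[of _ \<Sigma>]) (auto simp: \<Sigma>_def)
qed

end
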